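(* Let $n\ge1$ and $0\ne f\in F_{\mathbb Z^n}$. Then $|\operatorname{sm}(f)|$ is the order of vanishing of the Laurent polynomial $\pi_f=\sum_{a\in\mathbb Z^n}f(a)X^a\in\mathbb R[X_1^{\pm1},\dots,X_n^{\pm1}]$ at the point $(1,\dots,1)\in\mathbb R^n$.
   Context: $F_{\mathbb Z^n}$ is the set of finitely supported functions $f:\mathbb Z^n\to\mathbb R$. $\mathbb N$ is the set of nonnegative integers; for $e\in\mathbb N^n$, $|e|=e_1+\cdots+e_n$; $a^e=a_1^{e_1}\cdots a_n^{e_n}$. Monomials $X^e$ ($e\in\mathbb N^n$) are ordered by a degree-lexicographic monomial order (first by total degree $|e|$, ties broken lexicographically). For $f\neq0$, $\operatorname{sm}(f)\in\mathbb N^n$ is the exponent such that $X^{\operatorname{sm}(f)}$ is the smallest monomial $X^e$ with $\sum_{a\in\mathbb Z^n}f(a)a^e\ne0$. The order of vanishing of $\pi_f$ at $(1,\dots,1)$ is the largest $d\ge0$ such that all partial derivatives $\partial_1^{e_1}\cdots\partial_n^{e_n}\pi_f$ with $|e|<d$ vanish at $(1,\dots,1)$. *)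

theory Defs
  imports "HOL-Analysis.Analysis" "HOL-Library.Poly_Mapping" "HOL-Library.Fun_Lexorder"
begin

definition fin_supp_funs :: "('a \<Rightarrow> real) set" where
  "fin_supp_funs = {f. finite {a. f a \<noteq> 0}}"

definition total_degree :: "nat ^ 'n::finite \<Rightarrow> nat" where
  "total_degree e = (\<Sum>i\<in>UNIV. e $ i)"

text \<open>
  The index type \<^typ>\<open>'n::{finite,linorder}\<close> plays the role of \<open>{1..n}\<close>; its order is the order of the
  variables. The smallest variable is the leading one, so \<^const>\<open>less_fun\<close> compares exponent
  vectors at the first index where they differ.
\<close>

definition deglex_le :: "nat ^ 'n::{finite,linorder} \<Rightarrow> nat ^ 'n::{finite,linorder} \<Rightarrow> bool" where
  "deglex_le e e' \<longleftrightarrow>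
     total_degree e < total_degree e' \<or>
     (total_degree e = total_degree e' \<and> (e = e' \<or> less_fun (($) e) (($) e')))"

definition moment :: "(int ^ 'n::finite \<Rightarrow> real) \<Rightarrow> nat ^ 'n \<Rightarrow> real" where
  "moment f e = (\<Sum>a | f a \<noteq> 0. f a * (\<Prod>i\<in>UNIV. real_of_int (a $ i) ^ (e $ i)))"

definition sm :: "(int ^ 'n::{finite,linorder} \<Rightarrow> real) \<Rightarrow> nat ^ 'n::{finite,linorder}" where
  "sm f = (THE e. moment f e \<noteq> 0 \<and> (\<forall>e'. moment f e' \<noteq> 0 \<longrightarrow> deglex_le e e'))"

text \<open>
  The ring of Laurent polynomials in the variables indexed by \<open>'n\<close> is the group ring of
  \<^typ>\<open>int ^ 'n::finite\<close>, with \<^term>\<open>Poly_Mapping.single a c\<close> standing for \<open>c X\<^sup>a\<close>.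
\<close>

type_synonym 'n laurent_poly = "(int ^ 'n) \<Rightarrow>\<^sub>0 real"

definition laurent_of :: "(int ^ 'n::finite \<Rightarrow> real) \<Rightarrow> 'n laurent_poly" where
  "laurent_of f = (\<Sum>a | f a \<noteq> 0. Poly_Mapping.single a (f a))"

text \<open>
  As a function on \<open>\<real>\<^sup>n\<close>, this is meaningful where all coordinates are nonzero; elsewhere negative
  powers of \<open>0\<close> take the default value \<open>0\<close>. Derivatives at \<open>(1,\<dots>,1)\<close> only depend on a neighbourhood of
  that point.
\<close>

definition laurent_eval :: "'n::finite laurent_poly \<Rightarrow> real ^ 'n \<Rightarrow> real" where
  "laurent_eval p x =
     (\<Sum>a\<in>Poly_Mapping.keys p. Poly_Mapping.lookup p a * (\<Prod>i\<in>UNIV. (x $ i) powi (a $ i)))"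

definition partial_deriv :: "'n::finite \<Rightarrow> (real ^ 'n \<Rightarrow> real) \<Rightarrow> real ^ 'n \<Rightarrow> real" where
  "partial_deriv i g x = deriv (\<lambda>t. g (x + t *\<^sub>R axis i 1)) 0"

text \<open>\<open>\<partial>\<^sub>1\<^bsup>e\<^sub>1\<^esup> \<dots> \<partial>\<^sub>n\<^bsup>e\<^sub>n\<^esup> g\<close>, with the derivatives in the last variable taken first.\<close>

definition iter_partial ::
  "nat ^ 'n::{finite,linorder} \<Rightarrow> (real ^ 'n::{finite,linorder} \<Rightarrow> real) \<Rightarrow> real ^ 'n::{finite,linorder} \<Rightarrow> real" where
  "iter_partial e g =
     foldr (\<lambda>i. partial_deriv i ^^ (e $ i)) (sorted_list_of_set UNIV) g"

definition vanishes_to_order ::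
  "(real ^ 'n::{finite,linorder} \<Rightarrow> real) \<Rightarrow> real ^ 'n::{finite,linorder} \<Rightarrow> nat \<Rightarrow> bool" where
  "vanishes_to_order g x d \<longleftrightarrow> (\<forall>e. total_degree e < d \<longrightarrow> iter_partial e g x = 0)"

definition is_order_of_vanishing ::
  "(real ^ 'n::{finite,linorder} \<Rightarrow> real) \<Rightarrow> real ^ 'n::{finite,linorder} \<Rightarrow> nat \<Rightarrow> bool" where
  "is_order_of_vanishing g x d \<longleftrightarrow>
     vanishes_to_order g x d \<and> (\<forall>d'. vanishes_to_order g x d' \<longrightarrow> d' \<le> d)"

end

theory Submission
  imports Defs "HOL-Computational_Algebra.Polynomial"
begin

text \<open>
  On the positive orthant, \<open>\<partial>\<^sup>e X\<^sup>a\<close> is the product of the falling factorials of the \<open>a\<^sub>i\<close> of length \<open>e\<^sub>i\<close>,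
  times \<open>X\<^bsup>a-e\<^esup>\<close>. Hence at \<open>(1,\<dots>,1)\<close> the derivative \<open>\<partial>\<^sup>e \<pi>\<^sub>f\<close> is a factorial moment of \<open>f\<close>. Since the product
  of falling factorials equals \<open>a\<^sup>e\<close> plus terms of lower total degree, and the moments of total degree
  below \<open>|sm(f)|\<close> vanish, factorial and ordinary moments coincide up to total degree \<open>|sm(f)|\<close>.
\<close>

section \<open>Moments against products of polynomials\<close>

lemma prod_poly_expand:
  fixes p :: "'n::finite \<Rightarrow> real poly"
  shows "(\<Prod>i\<in>UNIV. poly (p i) (x i)) =
    (\<Sum>\<phi>\<in>PiE UNIV (\<lambda>i. {..degree (p i)}). (\<Prod>i\<in>UNIV. coeff (p i) (\<phi> i)) * (\<Prod>i\<in>UNIV. x i ^ \<phi> i))"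
  by (simp add: poly_altdef prod_sum_PiE prod.distrib)

text \<open>Pairing \<open>f\<close> with a product of univariate polynomials gives a linear
  combination of moments. This serves twice: for separating polynomials and for falling
  factorials.\<close>

lemma moment_poly_expand:
  fixes f :: "int ^ 'n::finite \<Rightarrow> real" and p :: "'n \<Rightarrow> real poly"
  shows "(\<Sum>a | f a \<noteq> 0. f a * (\<Prod>i\<in>UNIV. poly (p i) (of_int (a $ i)))) =
    (\<Sum>\<phi>\<in>PiE UNIV (\<lambda>i. {..degree (p i)}). (\<Prod>i\<in>UNIV. coeff (p i) (\<phi> i)) * moment f (\<chi> i. \<phi> i))"
proof -
  have "(\<Sum>a | f a \<noteq> 0. f a * (\<Prod>i\<in>UNIV. poly (p i) (of_int (a $ i)))) =
    (\<Sum>a | f a \<noteq> 0. \<Sum>\<phi>\<in>PiE UNIV (\<lambda>i. {..degree (p i)}).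
      (\<Prod>i\<in>UNIV. coeff (p i) (\<phi> i)) * (f a * (\<Prod>i\<in>UNIV. of_int (a $ i) ^ \<phi> i)))"
    by (simp add: prod_poly_expand sum_distrib_left mult_ac)
  then show ?thesis
    by (simp add: sum.swap[where A = "{a. f a \<noteq> 0}"] moment_def sum_distrib_left)
qed

text \<open>If every moment vanished, \<open>f\<close> would pair to zero with every product of
  univariate polynomials, including one that isolates the value at \<open>b\<close>.\<close>

lemma ex_moment_nonzero:
  fixes f :: "int ^ 'n::finite \<Rightarrow> real"
  assumes fin: "finite {a. f a \<noteq> 0}" and nz: "f b \<noteq> 0"
  shows "\<exists>e. moment f e \<noteq> 0"
proof (rule ccontr)
  assume "\<nexists>e. moment f e \<noteq> 0"
  then have zero: "moment f e = 0" for e by auto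
  \<comment> \<open>The product of the \<open>p i\<close> separates \<open>b\<close> from the rest of the support.\<close>
  define C where "C i = (\<lambda>a. a $ i) ` {a. f a \<noteq> 0} - {b $ i}" for i
  define p :: "'n \<Rightarrow> real poly" where "p i = (\<Prod>c\<in>C i. [:- of_int c, 1:])" for i
  have finC: "finite (C i)" for i
    using fin by (simp add: C_def)
  have poly_p: "poly (p i) x = (\<Prod>c\<in>C i. x - of_int c)" for i x
    by (simp add: p_def poly_prod)
  have vanish: "(\<Prod>i\<in>UNIV. poly (p i) (of_int (a $ i))) = 0" if "f a \<noteq> 0" "a \<noteq> b" for a
  proof -
    obtain i where "a $ i \<noteq> b $ i"
      using \<open>a \<noteq> b\<close> by (auto simp: vec_eq_iff)
    then have "a $ i \<in> C i"
      using \<open>f a \<noteq> 0\<close> by (auto simp: C_def)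
    then have "poly (p i) (of_int (a $ i)) = 0"
      using finC by (auto simp: poly_p)
    then show ?thesis
      by auto
  qed
  have "(\<Sum>a | f a \<noteq> 0. f a * (\<Prod>i\<in>UNIV. poly (p i) (of_int (a $ i)))) =
        (\<Sum>a\<in>{b}. f a * (\<Prod>i\<in>UNIV. poly (p i) (of_int (a $ i))))"
    using fin nz vanish by (intro sum.mono_neutral_right) auto
  moreover have "poly (p i) (of_int (b $ i)) \<noteq> 0" for i
    using finC by (auto simp: poly_p C_def)
  ultimately have "(\<Sum>a | f a \<noteq> 0. f a * (\<Prod>i\<in>UNIV. poly (p i) (of_int (a $ i)))) \<noteq> 0"
    using nz by simp
  then show False
    unfolding moment_poly_expand by (simp add: zero)
qed

text \<open>The falling factorial is kept as a polynomial because its degree and leading coefficient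
  are what the expansion into moments uses.\<close>

definition ffact_poly :: "nat \<Rightarrow> 'a::idom poly" where
  "ffact_poly k = (\<Prod>j<k. [:- of_nat j, 1:])"

lemma ffact_poly_0 [simp]: "ffact_poly 0 = 1"
  by (simp add: ffact_poly_def)

lemma poly_ffact_poly_Suc: "poly (ffact_poly (Suc k)) x = poly (ffact_poly k) x * (x - of_nat k)"
  by (simp add: ffact_poly_def poly_prod algebra_simps)

lemma degree_ffact_poly [simp]: "degree (ffact_poly k) = k"
  by (simp add: ffact_poly_def degree_prod_sum_eq)

lemma coeff_ffact_poly_self [simp]: "coeff (ffact_poly k) k = 1"
proof -
  have "coeff (ffact_poly k) k = lead_coeff (ffact_poly k :: 'a poly)"
    by simp
  also have "\<dots> = 1"
    by (simp only: ffact_poly_def lead_coeff_prod) simp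
  finally show ?thesis .
qed

lemma factorial_moment_eq_moment:
  fixes f :: "int ^ 'n::finite \<Rightarrow> real"
  assumes "\<And>e'. total_degree e' < total_degree e \<Longrightarrow> moment f e' = 0"
  shows "(\<Sum>a | f a \<noteq> 0. f a * (\<Prod>i\<in>UNIV. poly (ffact_poly (e $ i)) (of_int (a $ i)))) = moment f e"
proof -
  let ?P = "PiE UNIV (\<lambda>i. {..e $ i})"
  \<comment> \<open>An exponent that is componentwise at most \<open>e\<close> and differs from it
    has strictly smaller total degree.\<close>
  have lower: "moment f (\<chi> i. \<phi> i) = 0" if "\<phi> \<in> ?P" "\<phi> \<noteq> ($) e" for \<phi>
  proof (rule assms)
    obtain i where "\<phi> i \<noteq> e $ i"
      using \<open>\<phi> \<noteq> ($) e\<close> by auto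
    with that show "total_degree (\<chi> i. \<phi> i) < total_degree e"
      unfolding total_degree_def
      by (intro sum_strict_mono_ex1) (auto intro!: exI[of _ i] simp: le_neq_implies_less PiE_iff)
  qed
  have "(\<Sum>a | f a \<noteq> 0. f a * (\<Prod>i\<in>UNIV. poly (ffact_poly (e $ i)) (of_int (a $ i)))) =
    (\<Sum>\<phi>\<in>?P. (\<Prod>i\<in>UNIV. coeff (ffact_poly (e $ i)) (\<phi> i)) * moment f (\<chi> i. \<phi> i))"
    by (simp add: moment_poly_expand)
  also have "\<dots> = (\<Sum>\<phi>\<in>{($) e}. (\<Prod>i\<in>UNIV. coeff (ffact_poly (e $ i)) (\<phi> i)) * moment f (\<chi> i. \<phi> i))"
    using lower by (intro sum.mono_neutral_right finite_PiE) auto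
  finally show ?thesis
    by simp
qed

section \<open>The smallest monomial\<close>

lemma finite_total_degree_eq: "finite {e :: nat ^ 'n::finite. total_degree e = d}"
proof (rule finite_subset)
  have "e $ i \<le> total_degree e" for e :: "nat ^ 'n" and i
    unfolding total_degree_def by (rule member_le_sum) auto
  then show "{e :: nat ^ 'n. total_degree e = d} \<subseteq> vec_lambda ` (PiE UNIV (\<lambda>_. {..d}))"
    by (auto intro!: image_eqI[of _ _ "($) e" for e])
  show "finite (vec_lambda ` (PiE UNIV (\<lambda>_. {..d})) :: (nat ^ 'n) set)"
    by (intro finite_imageI finite_PiE) auto
qed

text \<open>Minimising the total degree first leaves finitely many exponents, so a lexicographically
  minimal one exists; trichotomy of \<open>less_fun\<close> over the finite index type makes it
  least.\<close>

lemma ex_deglex_least: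
  fixes S :: "(nat ^ 'n::{finite,linorder}) set"
  assumes "S \<noteq> {}"
  shows "\<exists>e\<in>S. \<forall>e'\<in>S. deglex_le e e'"
proof -
  obtain s where "s \<in> S" and s: "\<And>e. e \<in> S \<Longrightarrow> total_degree s \<le> total_degree e"
    using assms arg_min_nat_lemma[of "\<lambda>e. e \<in> S" _ total_degree] by blast
  let ?M = "($) ` {e \<in> S. total_degree e = total_degree s}"
  have "finite ?M"
    by (rule finite_imageI, rule finite_subset[OF _ finite_total_degree_eq[of "total_degree s"]]) auto
  moreover have "?M \<noteq> {}"
    using \<open>s \<in> S\<close> by auto
  ultimately obtain m where m: "m \<in> ?M" "\<forall>b\<in>?M. less_fun b m \<or> b = m \<longrightarrow> m = b"
    using order.finite_has_minimal[OF order_less_fun, of ?M] by blast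
  then obtain e where e: "e \<in> S" "total_degree e = total_degree s" "m = ($) e"
    by auto
  have "deglex_le e e'" if "e' \<in> S" for e'
  proof (cases "total_degree e' = total_degree s")
    case True
    then have "\<not> less_fun (($) e') (($) e)"
      using that True m(2) e(3) less_fun_irrefl[of m] by auto
    moreover have "less_fun (($) e) (($) e') \<or> ($) e = ($) e' \<or> less_fun (($) e') (($) e)"
      by (rule less_fun_trichotomy) auto
    ultimately show ?thesis
      using e True by (auto simp: deglex_le_def vec_nth_inject)
  next
    case False
    then show ?thesis
      using s[OF that] e by (auto simp: deglex_le_def)
  qed
  with e show ?thesis by blast
qed

lemma deglex_le_antisym: "deglex_le e e' \<Longrightarrow> deglex_le e' e \<Longrightarrow> e = e'"
  by (auto simp: deglex_le_def dest: less_fun_asym)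

lemma sm_spec:
  fixes f :: "int ^ 'n::{finite,linorder} \<Rightarrow> real"
  assumes "moment f e \<noteq> 0"
  shows "moment f (sm f) \<noteq> 0" and "moment f e' \<noteq> 0 \<Longrightarrow> deglex_le (sm f) e'"
proof -
  obtain m where "moment f m \<noteq> 0" "\<And>e'. moment f e' \<noteq> 0 \<Longrightarrow> deglex_le m e'"
    using ex_deglex_least[of "{e. moment f e \<noteq> 0}"] assms by auto
  then have "\<exists>!e. moment f e \<noteq> 0 \<and> (\<forall>e'. moment f e' \<noteq> 0 \<longrightarrow> deglex_le e e')"
    by (intro ex1I[of _ m]) (auto intro: deglex_le_antisym)
  from theI'[OF this]
  show "moment f (sm f) \<noteq> 0" and "moment f e' \<noteq> 0 \<Longrightarrow> deglex_le (sm f) e'"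
    by (auto simp: sm_def)
qed

section \<open>Iterated partial derivatives of Laurent polynomials\<close>

text \<open>The closed form of the iterated derivative where all coordinates are positive. The
  exponent is a plain function, so that differentiating once more is a function update.\<close>

definition laurent_deriv :: "(int ^ 'n::finite \<Rightarrow> real) \<Rightarrow> ('n \<Rightarrow> nat) \<Rightarrow> real ^ 'n \<Rightarrow> real" where
  "laurent_deriv f e x = (\<Sum>a | f a \<noteq> 0. f a *
     (\<Prod>i\<in>UNIV. poly (ffact_poly (e i)) (of_int (a $ i)) * (x $ i) powi (a $ i - int (e i))))"

lemma lookup_laurent_of:
  assumes "finite {a. f a \<noteq> 0}"
  shows "Poly_Mapping.lookup (laurent_of f) = f"
proof
  fix b
  show "Poly_Mapping.lookup (laurent_of f) b = f b"
    using assms by (simp add: laurent_of_def lookup_sum lookup_single when_def sum.delta)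
qed

lemma laurent_eval_laurent_of:
  assumes "finite {a. f a \<noteq> 0}"
  shows "laurent_eval (laurent_of f) = laurent_deriv f (\<lambda>_. 0)"
  by (simp add: fun_eq_iff laurent_eval_def laurent_deriv_def keys.rep_eq lookup_laurent_of[OF assms])

text \<open>Along axis \<open>i\<close> only the factor at \<open>i\<close> varies. The power rule
  contributes \<open>a $ i - e i\<close>, exactly the next factor of the falling factorial.\<close>

lemma has_field_derivative_laurent_deriv:
  fixes x :: "real ^ 'n::finite"
  assumes "x $ i \<noteq> 0"
  shows "((\<lambda>t. laurent_deriv f e (x + t *\<^sub>R axis i 1)) has_field_derivative
           laurent_deriv f (e(i := Suc (e i))) x) (at 0)"
proof -
  define F where "F e a j y = poly (ffact_poly (e j)) (of_int (a $ j)) * y powi (a $ j - int (e j))"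
    for e and a :: "int ^ 'n" and j and y :: real
  have split: "(\<Prod>j\<in>UNIV. F e a j (y j)) = F e a i (y i) * (\<Prod>j\<in>UNIV - {i}. F e a j (y j))"
    for e a y by (simp add: prod.remove[of UNIV i])
  have rest: "(\<Prod>j\<in>UNIV - {i}. F e a j ((x + t *\<^sub>R axis i 1) $ j)) = (\<Prod>j\<in>UNIV - {i}. F e a j (x $ j))"
    for a t by (intro prod.cong) (auto simp: axis_def)
  have rest': "(\<Prod>j\<in>UNIV - {i}. F (e(i := Suc (e i))) a j (x $ j)) = (\<Prod>j\<in>UNIV - {i}. F e a j (x $ j))"
    for a by (intro prod.cong) (auto simp: F_def)
  have factor: "((\<lambda>t. F e a i ((x + t *\<^sub>R axis i 1) $ i)) has_field_derivative
                   F (e(i := Suc (e i))) a i (x $ i)) (at 0)" for a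
    using assms unfolding F_def
    by (auto intro!: derivative_eq_intros simp: axis_def poly_ffact_poly_Suc algebra_simps)
  have eq: "laurent_deriv f e y = (\<Sum>a | f a \<noteq> 0. f a * (\<Prod>j\<in>UNIV. F e a j (y $ j)))" for e y
    by (simp add: laurent_deriv_def F_def)
  show ?thesis
    unfolding eq split rest rest'
    by (intro DERIV_sum DERIV_cmult DERIV_cmult_right factor)
qed

text \<open>Agreement is assumed on the whole open positive orthant, not just at \<open>x\<close>,
  since a derivative depends on nearby values; the conclusion again holds throughout the orthant, so
  the step can be iterated.\<close>

lemma partial_deriv_laurent_deriv:
  fixes g :: "real ^ 'n::finite \<Rightarrow> real"
  assumes g: "\<And>y. (\<And>j. y $ j > 0) \<Longrightarrow> g y = laurent_deriv f e y" and x: "\<And>j. x $ j > 0"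
  shows "partial_deriv i g x = laurent_deriv f (e(i := Suc (e i))) x"
  unfolding partial_deriv_def
proof (rule DERIV_imp_deriv, rule has_field_derivative_transform_within_open)
  show "((\<lambda>t. laurent_deriv f e (x + t *\<^sub>R axis i 1)) has_field_derivative
           laurent_deriv f (e(i := Suc (e i))) x) (at 0)"
    using x[of i] by (intro has_field_derivative_laurent_deriv) simp
  \<comment> \<open>For these \<open>t\<close> the shifted point stays in the positive
    orthant.\<close>
  show "open {- x $ i <..}" "0 \<in> {- x $ i <..}"
    using x by auto
  show "laurent_deriv f e (x + t *\<^sub>R axis i 1) = g (x + t *\<^sub>R axis i 1)" if "t \<in> {- x $ i <..}" for t
    using x that by (intro g[symmetric]) (auto simp: axis_def)
qed

lemma partial_deriv_funpow_laurent_deriv: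
  fixes g :: "real ^ 'n::finite \<Rightarrow> real"
  assumes g: "\<And>y. (\<And>j. y $ j > 0) \<Longrightarrow> g y = laurent_deriv f e y" and x: "\<And>j. x $ j > 0"
  shows "(partial_deriv i ^^ k) g x = laurent_deriv f (e(i := e i + k)) x"
  using x
proof (induction k arbitrary: x)
  case (Suc k)
  have "partial_deriv i ((partial_deriv i ^^ k) g) x =
        laurent_deriv f ((e(i := e i + k))(i := Suc ((e(i := e i + k)) i))) x"
    using Suc by (intro partial_deriv_laurent_deriv) (auto simp: fun_upd_def)
  then show ?case
    by (simp only: fun_upd_upd fun_upd_same funpow.simps o_apply add_Suc_right)
qed (simp add: g)

text \<open>Distinctness ensures that the head variable still has exponent 0 when its derivatives
  are applied after those of the tail.\<close>

lemma foldr_partial_deriv_laurent_deriv: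
  fixes g :: "real ^ 'n::finite \<Rightarrow> real"
  assumes "\<And>y. (\<And>j. y $ j > 0) \<Longrightarrow> g y = laurent_deriv f (\<lambda>_. 0) y"
    and "distinct xs" and "\<And>j. x $ j > 0"
  shows "foldr (\<lambda>i. partial_deriv i ^^ (e $ i)) xs g x =
         laurent_deriv f (\<lambda>i. if i \<in> set xs then e $ i else 0) x"
  using assms(2,3)
proof (induction xs arbitrary: x)
  case (Cons i xs)
  let ?e = "\<lambda>i. if i \<in> set xs then e $ i else 0"
  have "foldr (\<lambda>i. partial_deriv i ^^ (e $ i)) (i # xs) g x = laurent_deriv f (?e(i := ?e i + e $ i)) x"
    using Cons by (simp add: partial_deriv_funpow_laurent_deriv)
  also have "?e(i := ?e i + e $ i) = (\<lambda>j. if j \<in> set (i # xs) then e $ j else 0)"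
    using Cons.prems by auto
  finally show ?case .
qed (simp add: assms(1))

lemma iter_partial_laurent_of_at_one:
  fixes f :: "int ^ 'n::{finite,linorder} \<Rightarrow> real"
  assumes "finite {a. f a \<noteq> 0}"
  shows "iter_partial e (laurent_eval (laurent_of f)) (\<chi> i. 1) =
    (\<Sum>a | f a \<noteq> 0. f a * (\<Prod>i\<in>UNIV. poly (ffact_poly (e $ i)) (of_int (a $ i))))"
  unfolding iter_partial_def laurent_eval_laurent_of[OF assms]
  by (subst foldr_partial_deriv_laurent_deriv[where f = f]) (simp_all add: laurent_deriv_def)

theorem lemma15:
  fixes f :: "int ^ 'n::{finite,linorder} \<Rightarrow> real"
  assumes "f \<in> fin_supp_funs"
    and "f \<noteq> (\<lambda>_. 0)"
  shows "is_order_of_vanishing (laurent_eval (laurent_of f)) (\<chi> i. 1) (total_degree (sm f))"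
proof -
  have fin: "finite {a. f a \<noteq> 0}"
    using assms(1) by (simp add: fin_supp_funs_def)
  obtain b where "f b \<noteq> 0"
    using assms(2) by auto
  then obtain e\<^sub>0 where e\<^sub>0: "moment f e\<^sub>0 \<noteq> 0"
    using ex_moment_nonzero[OF fin] by blast
  \<comment> \<open>Total degree is compared first, so a nonzero moment here would contradict
    minimality of \<open>sm f\<close>.\<close>
  have low: "moment f e = 0" if "total_degree e < total_degree (sm f)" for e
    using sm_spec(2)[OF e\<^sub>0, of e] that by (auto simp: deglex_le_def)
  have deriv: "iter_partial e (laurent_eval (laurent_of f)) (\<chi> i. 1) = moment f e"
    if "total_degree e \<le> total_degree (sm f)" for e
    using that low
    by (simp add: iter_partial_laurent_of_at_one[OF fin] factorial_moment_eq_moment)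
  \<comment> \<open>The derivative at \<open>sm f\<close> itself is a nonzero moment, which rules
    out any larger order.\<close>
  show ?thesis
    unfolding is_order_of_vanishing_def vanishes_to_order_def
    using deriv[of "sm f"] sm_spec(1)[OF e\<^sub>0] deriv low by (auto simp: not_less[symmetric])
qed

end
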